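(* For all $i,j\in\{1,\dots,n\}$ and $t\in\mathbb{T}_n$, the following equalities hold: $$c_{ij;t}^{\mathrm{g}}=\sum_{l=1}^{r_i}c_{il,jm_0;t}^{\mathrm{c}}=\frac{r_i}{r_j}\sum_{m=1}^{r_j}c_{il_0,jm;t}^{\mathrm{c}}=r_i\tilde{c}_{ij;t}^{\mathrm{c}}+\sigma_{j;t}\delta_{ij},$$ $$g_{ij;t}^{\mathrm{g}}=\sum_{m=1}^{r_j}g_{il_0,jm;t}^{\mathrm{c}}=\frac{r_j}{r_i}\sum_{l=1}^{r_i}g_{il,jm_0;t}^{\mathrm{c}}=r_j\tilde{g}_{ij;t}^{\mathrm{c}}+\sigma_{j;t}\delta_{ij},$$ where $l_0\in\{1,\dots,r_i\}$ and $m_0\in\{1,\dots,r_j\}$ are arbitrary.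
   Context: Notation: $[a]_+=\max(a,0)$; $\delta$ is the Kronecker delta ($\delta_{ij}$ on $\{1,\dots,n\}$, $\delta_{il,jm}$ on $\mathcal{D}$). Fix $n\ge1$, ${\bf r}=(r_1,\dots,r_n)\in\mathbb{Z}_{\ge1}^n$. $\mathbb{T}_n$ is the $n$-regular tree with edges labeled $1,\dots,n$ (the $n$ edges at each vertex having distinct labels); vertices joined by an edge labeled $k$ are $k$-adjacent; $t_0$ is a fixed vertex. Generalized side. Let $B_{t_0}$ be a skew-symmetrizable integer $n\times n$ matrix (the initial exchange matrix of a generalized cluster pattern with mutation degree ${\bf r}$). The exchange matrices $B_t=(b_{ij;t})$ are determined by: for $k$-adjacent $t,t'$, $b_{ij;t'}=-b_{ij;t}$ if $i=k$ or $j=k$, else $b_{ij;t'}=b_{ij;t}+r_k(b_{ik;t}[b_{kj;t}]_++[-b_{ik;t}]_+b_{kj;t})$. The $C$-matrices $C^{\mathrm{g}}_t=(c^{\mathrm{g}}_{ij;t})$ and $G$-matrices $G^{\mathrm{g}}_t=(g^{\mathrm{g}}_{ij;t})$ of the generalized pattern are determined by $c^{\mathrm{g}}_{ij;t_0}=g^{\mathrm{g}}_{ij;t_0}=\delta_{ij}$ and, for $k$-adjacent $t,t'$: $c^{\mathrm{g}}_{ik;t'}=-c^{\mathrm{g}}_{ik;t}$; $c^{\mathrm{g}}_{ij;t'}=c^{\mathrm{g}}_{ij;t}+r_k(c^{\mathrm{g}}_{ik;t}[b_{kj;t}]_++[-c^{\mathrm{g}}_{ik;t}]_+b_{kj;t})$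 for $j\ne k$; $g^{\mathrm{g}}_{ik;t'}=-g^{\mathrm{g}}_{ik;t}+r_k\sum_{a=1}^n\bigl(g^{\mathrm{g}}_{ia;t}[-b_{ak;t}]_+-b_{ia;t_0}[-c^{\mathrm{g}}_{ak;t}]_+\bigr)$; $g^{\mathrm{g}}_{ij;t'}=g^{\mathrm{g}}_{ij;t}$ for $j\neq k$. Composite side. Let $\mathcal{D}=\{(i,l)\mid 1\le i\le n,\ 1\le l\le r_i\}$ and $\mathcal{B}_{t_0}$ the $\mathcal{D}\times\mathcal{D}$ matrix with $((i,l),(j,m))$ entry $b_{ij;t_0}$. For triples $(\mathcal{B},C,G)$ of $\mathcal{D}\times\mathcal{D}$ matrices with entries $b_{\iota\lambda},c_{\iota\lambda},g_{\iota\lambda}$, the ordinary mutation $\mu_\kappa$ in direction $\kappa\in\mathcal{D}$ is given by the same formulas with index set $\mathcal{D}$, all $r$'s equal to $1$ and initial exchange matrix $\mathcal{B}_{t_0}$: $b'_{\iota\lambda}=-b_{\iota\lambda}$ if $\iota=\kappa$ or $\lambda=\kappa$, else $b_{\iota\lambda}+b_{\iota\kappa}[b_{\kappa\lambda}]_++[-b_{\iota\kappa}]_+b_{\kappa\lambda}$; $c'_{\iota\kappa}=-c_{\iota\kappa}$, $c'_{\iota\lambda}=c_{\iota\lambda}+c_{\iota\kappa}[b_{\kappa\lambda}]_++[-c_{\iota\kappa}]_+b_{\kappa\lambda}$ ($\lambda\ne\kappa$); $g'_{\iota\kappa}=-g_{\iota\kappa}+\sum_{\lambda\in\mathcal{D}}\bigl(g_{\iota\lambda}[-b_{\lambda\kappa}]_+-(\mathcal{B}_{t_0})_{\iota\lambda}[-c_{\lambda\kappa}]_+\bigr)$,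 $g'_{\iota\lambda}=g_{\iota\lambda}$ ($\lambda\ne\kappa$). The matrices $C^{\mathrm{c}}_t=(c^{\mathrm{c}}_{il,jm;t})$, $G^{\mathrm{c}}_t=(g^{\mathrm{c}}_{il,jm;t})$ ($t\in\mathbb{T}_n$) of the composite cluster pattern are determined by $C^{\mathrm{c}}_{t_0}=G^{\mathrm{c}}_{t_0}=$ identity and, for $k$-adjacent $t,t'$, $(\mathcal{B}_{t'},C^{\mathrm{c}}_{t'},G^{\mathrm{c}}_{t'})=\mu_{kr_k}\circ\cdots\circ\mu_{k2}\circ\mu_{k1}(\mathcal{B}_t,C^{\mathrm{c}}_t,G^{\mathrm{c}}_t)$, where $\mu_{kl}$ is the mutation in direction $(k,l)$. Signs: $\sigma_{i;t}\in\{\pm1\}$ is defined by $\sigma_{i;t_0}=1$ and, for $k$-adjacent $t,t'$, $\sigma_{k;t'}=-\sigma_{k;t}$, $\sigma_{i;t'}=\sigma_{i;t}$ ($i\ne k$). Set $\tilde c^{\mathrm{c}}_{ij;t}=c^{\mathrm{c}}_{il,jm;t}-\sigma_{j;t}\delta_{il,jm}$ and $\tilde g^{\mathrm{c}}_{ij;t}=g^{\mathrm{c}}_{il,jm;t}-\sigma_{j;t}\delta_{il,jm}$; these are independent of $l\in\{1,\dots,r_i\}$ and $m\in\{1,\dots,r_j\}$. *)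

theory Defs
  imports Complex_Main
begin

section \<open>The edge-labeled regular tree\<close>

text \<open>Trees are undirected simple graphs, an edge being the set of its two endpoints. The notion of
  tree in the AFP entry Graph_Theory is not suitable: it forbids directed cycles, and a symmetric
  digraph with at least one edge always has a directed cycle of length two.\<close>

definition simple_graph :: "'v set \<Rightarrow> 'v set set \<Rightarrow> bool" where
  "simple_graph V E \<longleftrightarrow> (\<forall>e\<in>E. \<exists>u\<in>V. \<exists>v\<in>V. u \<noteq> v \<and> e = {u, v})"

definition connected_graph :: "'v set \<Rightarrow> 'v set set \<Rightarrow> bool" where
  "connected_graph V E \<longleftrightarrow> V \<noteq> {} \<and> (\<forall>u\<in>V. \<forall>v\<in>V. (\<lambda>x y. {x, y} \<in> E)\<^sup>*\<^sup>* u v)"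

definition acyclic_graph :: "'v set set \<Rightarrow> bool" where
  "acyclic_graph E \<longleftrightarrow>
    \<not> (\<exists>p. length p \<ge> 3 \<and> distinct p \<and> successively (\<lambda>x y. {x, y} \<in> E) p \<and> {last p, hd p} \<in> E)"

definition tree_graph :: "'v set \<Rightarrow> 'v set set \<Rightarrow> bool" where
  "tree_graph V E \<longleftrightarrow> simple_graph V E \<and> connected_graph V E \<and> acyclic_graph E"

text \<open>At each vertex, the labeling is a bijection from the incident edges to the \<open>n\<close> labels; this
  expresses both \<open>n\<close>-regularity and the distinctness of the labels.\<close>

definition labeled_regular_tree :: "nat \<Rightarrow> 'v set \<Rightarrow> 'v set set \<Rightarrow> ('v set \<Rightarrow> nat) \<Rightarrow> bool" where
  "labeled_regular_tree n V E lab \<longleftrightarrow>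
    tree_graph V E \<and> (\<forall>v\<in>V. bij_betw lab {e \<in> E. v \<in> e} {1..n})"

definition k_adjacent :: "'v set set \<Rightarrow> ('v set \<Rightarrow> nat) \<Rightarrow> nat \<Rightarrow> 'v \<Rightarrow> 'v \<Rightarrow> bool" where
  "k_adjacent E lab k t t' \<longleftrightarrow> {t, t'} \<in> E \<and> lab {t, t'} = k"

section \<open>Matrix mutation\<close>

text \<open>Matrices with rows and columns indexed by a finite set \<open>I\<close> are functions of two arguments; only
  the values on \<open>I \<times> I\<close> matter.\<close>

type_synonym 'i mat = "'i \<Rightarrow> 'i \<Rightarrow> int"

abbreviation pos :: "int \<Rightarrow> int" where
  "pos a \<equiv> max a 0"

abbreviation delta :: "'i mat" where
  "delta i j \<equiv> of_bool (i = j)"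

definition skew_symmetrizable :: "'i set \<Rightarrow> 'i mat \<Rightarrow> bool" where
  "skew_symmetrizable I b \<longleftrightarrow>
    (\<exists>d :: 'i \<Rightarrow> int. (\<forall>i\<in>I. d i > 0) \<and> (\<forall>i\<in>I. \<forall>j\<in>I. d i * b i j = - (d j * b j i)))"

text \<open>Here \<open>r\<close> gives the mutation degrees; ordinary mutation is the case \<open>r = (\<lambda>_. 1)\<close>.
  The argument \<open>b0\<close> is the initial exchange matrix.\<close>

definition mutate_B :: "('i \<Rightarrow> nat) \<Rightarrow> 'i \<Rightarrow> 'i mat \<Rightarrow> 'i mat" where
  "mutate_B r k b i j =
    (if i = k \<or> j = k then - b i j
     else b i j + int (r k) * (b i k * pos (b k j) + pos (- b i k) * b k j))"

definition mutate_C :: "('i \<Rightarrow> nat) \<Rightarrow> 'i \<Rightarrow> 'i mat \<Rightarrow> 'i mat \<Rightarrow> 'i mat" where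
  "mutate_C r k b c i j =
    (if j = k then - c i k
     else c i j + int (r k) * (c i k * pos (b k j) + pos (- c i k) * b k j))"

definition mutate_G ::
  "'i set \<Rightarrow> ('i \<Rightarrow> nat) \<Rightarrow> 'i mat \<Rightarrow> 'i \<Rightarrow> 'i mat \<Rightarrow> 'i mat \<Rightarrow> 'i mat \<Rightarrow> 'i mat" where
  "mutate_G I r b0 k b c g i j =
    (if j = k
     then - g i k + int (r k) * (\<Sum>a\<in>I. g i a * pos (- b a k) - b0 i a * pos (- c a k))
     else g i j)"

fun mutate ::
  "'i set \<Rightarrow> ('i \<Rightarrow> nat) \<Rightarrow> 'i mat \<Rightarrow> 'i \<Rightarrow> 'i mat \<times> 'i mat \<times> 'i mat \<Rightarrow> 'i mat \<times> 'i mat \<times> 'i mat" where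
  "mutate I r b0 k (b, c, g) = (mutate_B r k b, mutate_C r k b c, mutate_G I r b0 k b c g)"

fun agree_on :: "'i set \<Rightarrow> 'i mat \<times> 'i mat \<times> 'i mat \<Rightarrow> 'i mat \<times> 'i mat \<times> 'i mat \<Rightarrow> bool" where
  "agree_on I (b, c, g) (b', c', g') \<longleftrightarrow>
    (\<forall>i\<in>I. \<forall>j\<in>I. b i j = b' i j \<and> c i j = c' i j \<and> g i j = g' i j)"

section \<open>Generalized and composite patterns\<close>

definition generalized_pattern ::
  "nat \<Rightarrow> (nat \<Rightarrow> nat) \<Rightarrow> 'v set set \<Rightarrow> ('v set \<Rightarrow> nat) \<Rightarrow> 'v \<Rightarrow> nat mat \<Rightarrow>
    ('v \<Rightarrow> nat mat) \<Rightarrow> ('v \<Rightarrow> nat mat) \<Rightarrow> ('v \<Rightarrow> nat mat) \<Rightarrow> bool" where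
  "generalized_pattern n r E lab t0 b0 B C G \<longleftrightarrow>
    agree_on {1..n} (B t0, C t0, G t0) (b0, delta, delta) \<and>
    (\<forall>k\<in>{1..n}. \<forall>t t'. k_adjacent E lab k t t' \<longrightarrow>
      agree_on {1..n} (B t', C t', G t') (mutate {1..n} r b0 k (B t, C t, G t)))"

definition composite_index :: "nat \<Rightarrow> (nat \<Rightarrow> nat) \<Rightarrow> (nat \<times> nat) set" where
  "composite_index n r = {(i, l). i \<in> {1..n} \<and> l \<in> {1..r i}}"

definition composite_matrix :: "nat mat \<Rightarrow> (nat \<times> nat) mat" where
  "composite_matrix b \<iota> \<kappa> = b (fst \<iota>) (fst \<kappa>)"

text \<open>The list fold applies the mutations in directions \<open>(k, 1)\<close>, \<open>(k, 2)\<close>, \<dots>, \<open>(k, r k)\<close> in this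
  order, \<open>(k, 1)\<close> being applied first.\<close>

definition composite_mutate ::
  "nat \<Rightarrow> (nat \<Rightarrow> nat) \<Rightarrow> nat mat \<Rightarrow> nat \<Rightarrow>
    (nat \<times> nat) mat \<times> (nat \<times> nat) mat \<times> (nat \<times> nat) mat \<Rightarrow>
    (nat \<times> nat) mat \<times> (nat \<times> nat) mat \<times> (nat \<times> nat) mat" where
  "composite_mutate n r b0 k =
    fold (\<lambda>l. mutate (composite_index n r) (\<lambda>_. 1) (composite_matrix b0) (k, l)) [1..<Suc (r k)]"

definition composite_pattern ::
  "nat \<Rightarrow> (nat \<Rightarrow> nat) \<Rightarrow> 'v set set \<Rightarrow> ('v set \<Rightarrow> nat) \<Rightarrow> 'v \<Rightarrow> nat mat \<Rightarrow>
    ('v \<Rightarrow> (nat \<times> nat) mat) \<Rightarrow> ('v \<Rightarrow> (nat \<times> nat) mat) \<Rightarrow> ('v \<Rightarrow> (nat \<times> nat) mat) \<Rightarrow> bool" where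
  "composite_pattern n r E lab t0 b0 B C G \<longleftrightarrow>
    agree_on (composite_index n r) (B t0, C t0, G t0) (composite_matrix b0, delta, delta) \<and>
    (\<forall>k\<in>{1..n}. \<forall>t t'. k_adjacent E lab k t t' \<longrightarrow>
      agree_on (composite_index n r) (B t', C t', G t')
        (composite_mutate n r b0 k (B t, C t, G t)))"

definition sign_pattern ::
  "nat \<Rightarrow> 'v set set \<Rightarrow> ('v set \<Rightarrow> nat) \<Rightarrow> 'v \<Rightarrow> ('v \<Rightarrow> nat \<Rightarrow> int) \<Rightarrow> bool" where
  "sign_pattern n E lab t0 \<sigma> \<longleftrightarrow>
    (\<forall>i\<in>{1..n}. \<sigma> t0 i = 1) \<and>
    (\<forall>k\<in>{1..n}. \<forall>t t'. k_adjacent E lab k t t' \<longrightarrow>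
      (\<forall>i\<in>{1..n}. \<sigma> t' i = (if i = k then - \<sigma> t i else \<sigma> t i)))"

text \<open>For the \<open>C\<close>- and \<open>G\<close>-matrices of a composite pattern, with \<open>s\<close> the signs at the same vertex,
  the entry of \<open>tilde s x\<close> at \<open>(i, l)\<close>, \<open>(j, m)\<close> does not depend on \<open>l\<close> and \<open>m\<close>. The pair indices are
  kept here, so that this independence is neither built into the definition nor assumed.\<close>

definition tilde :: "(nat \<Rightarrow> int) \<Rightarrow> (nat \<times> nat) mat \<Rightarrow> (nat \<times> nat) mat" where
  "tilde s x \<iota> \<kappa> = x \<iota> \<kappa> - s (fst \<kappa>) * delta \<iota> \<kappa>"

end

theory Submission
  imports Defs
begin

text \<open>Write the entries of the composite matrices as \<open>a i j + \<sigma> j * delta (i, l) (j, m)\<close>. Since the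
  exchange matrices stay skew-symmetrizable, their diagonal vanishes, so the mutations in directions
  \<open>(k, 1), \<dots>, (k, r k)\<close> do not interact and their contributions add up. It remains to see that the
  positive part commutes with sums along a block. This holds because \<open>a\<close> and \<open>a \<plusminus> 1\<close> are integers, so
  they are both nonnegative or both nonpositive.\<close>

section \<open>Mutation and skew-symmetrizability\<close>

text \<open>The symmetrizer is a parameter because mutation keeps the same \<open>d\<close>: one
  \<open>d\<close> chosen for the initial matrix then serves at every vertex.\<close>

definition symmetrized_by :: "('i \<Rightarrow> int) \<Rightarrow> 'i set \<Rightarrow> 'i mat \<Rightarrow> bool" where
  "symmetrized_by d I b \<longleftrightarrow>
    (\<forall>i\<in>I. d i > 0) \<and> (\<forall>i\<in>I. \<forall>j\<in>I. d i * b i j = - (d j * b j i))"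

lemma symmetrized_by_diagonal:
  assumes "symmetrized_by d I b" "i \<in> I"
  shows "b i i = 0"
proof -
  have "d i > 0" "d i * b i i = - (d i * b i i)"
    using assms unfolding symmetrized_by_def by blast+
  then show ?thesis
    by simp
qed

lemma symmetrized_by_cong:
  assumes "\<And>i j. i \<in> I \<Longrightarrow> j \<in> I \<Longrightarrow> b' i j = b i j"
  shows "symmetrized_by d I b' \<longleftrightarrow> symmetrized_by d I b"
  unfolding symmetrized_by_def using assms by (intro conj_cong ball_cong refl) simp_all

lemma mult_pos_left: "(d::int) \<ge> 0 \<Longrightarrow> d * pos a = pos (d * a)"
  by (auto simp: max_def mult_le_0_iff zero_le_mult_iff)

text \<open>Scaling by \<open>d\<close> and transposing exchanges the two products of the mutation
  formula up to sign. The correction term is therefore skew for the same \<open>d\<close>, whatever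
  the factor \<open>r k\<close>.\<close>

lemma symmetrized_by_mutate_B:
  assumes "symmetrized_by d I b" "k \<in> I"
  shows "symmetrized_by d I (mutate_B r k b)"
  unfolding symmetrized_by_def
proof (intro conjI ballI)
  show "d i > 0" if "i \<in> I" for i
    using that assms unfolding symmetrized_by_def by blast
  fix i j
  assume ij: "i \<in> I" "j \<in> I"
  have skew: "d x * b x y = - (d y * b y x)" if "x \<in> I" "y \<in> I" for x y
    using that assms unfolding symmetrized_by_def by blast
  have pos_skew: "d x * pos (- b x y) = d y * pos (b y x)" if "x \<in> I" "y \<in> I" for x y
  proof -
    have "d x \<ge> 0" "d y \<ge> 0"
      using that assms unfolding symmetrized_by_def by (blast intro: less_imp_le)+
    then show ?thesis
      using skew[OF that] by (simp add: mult_pos_left)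
  qed
  \<comment> \<open>The weight moves from \<open>x\<close> to \<open>k\<close> by
    \<open>skew\<close>, and from \<open>k\<close> to \<open>y\<close> by
    \<open>pos_skew\<close>.\<close>
  have half: "d x * (b x k * pos (b k y)) = - (d y * (pos (- b y k) * b k x))"
    if "x \<in> I" "y \<in> I" for x y
  proof -
    have "d x * (b x k * pos (b k y)) = - (b k x * (d k * pos (b k y)))"
      unfolding mult.assoc[symmetric] skew[OF that(1) assms(2)] by (simp add: ac_simps)
    then show ?thesis
      unfolding pos_skew[OF that(2) assms(2), symmetric] by (simp add: ac_simps)
  qed
  show "d i * mutate_B r k b i j = - (d j * mutate_B r k b j i)"
  proof (cases "i = k \<or> j = k")
    case True
    then show ?thesis
      using skew[OF ij] by (auto simp: mutate_B_def)
  next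
    case False
    have "d i * mutate_B r k b i j = d i * b i j
        + int (r k) * (d i * (b i k * pos (b k j)) + d i * (pos (- b i k) * b k j))"
      using False by (simp add: mutate_B_def algebra_simps)
    also have "\<dots> = - (d j * b j i)
        - int (r k) * (d j * (pos (- b j k) * b k i) + d j * (b j k * pos (b k i)))"
      using skew[OF ij] half[OF ij] half[OF ij(2,1)] by (simp add: algebra_simps)
    also have "\<dots> = - (d j * mutate_B r k b j i)"
      using False by (simp add: mutate_B_def algebra_simps)
    finally show ?thesis .
  qed
qed

section \<open>Successive mutations in mutually unrelated directions\<close>

text \<open>Since \<open>b\<close> vanishes between the directions in \<open>ks\<close>, each
  mutation leaves unchanged the rows and columns that steer the later ones. Every correction can
  thus be written with the original \<open>b\<close> and \<open>c\<close>, and the corrections add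
  up.\<close>

lemma fold_mutate_unrelated:
  assumes "distinct ks" "\<And>k k'. k \<in> set ks \<Longrightarrow> k' \<in> set ks \<Longrightarrow> b k k' = 0"
  shows "fold (mutate I (\<lambda>_. 1) b0) ks (b, c, g) =
    (\<lambda>i j. if i \<in> set ks \<or> j \<in> set ks then - b i j
       else b i j + (\<Sum>k\<in>set ks. b i k * pos (b k j) + pos (- b i k) * b k j),
     \<lambda>i j. if j \<in> set ks then - c i j
       else c i j + (\<Sum>k\<in>set ks. c i k * pos (b k j) + pos (- c i k) * b k j),
     \<lambda>i j. if j \<in> set ks
       then - g i j + (\<Sum>a\<in>I. g i a * pos (- b a j) - b0 i a * pos (- c a j)) else g i j)"
  using assms
\<comment> \<open>\<open>fold\<close> applies the last direction last, so it is split off at the end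
  and mutates the closed form already known for \<open>ks\<close>.\<close>
proof (induction ks rule: rev_induct)
  case Nil
  then show ?case by simp
next
  case (snoc k ks)
  let ?b = "\<lambda>i j. if i \<in> set ks \<or> j \<in> set ks then - b i j
       else b i j + (\<Sum>k\<in>set ks. b i k * pos (b k j) + pos (- b i k) * b k j)"
  let ?c = "\<lambda>i j. if j \<in> set ks then - c i j
       else c i j + (\<Sum>k\<in>set ks. c i k * pos (b k j) + pos (- c i k) * b k j)"
  let ?g = "\<lambda>i j. if j \<in> set ks
       then - g i j + (\<Sum>a\<in>I. g i a * pos (- b a j) - b0 i a * pos (- c a j)) else g i j"
  have k: "k \<notin> set ks"
    using snoc.prems by simp
  have zero: "b x y = 0" if "x \<in> insert k (set ks)" "y \<in> insert k (set ks)" for x y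
    using snoc.prems that by simp
  \<comment> \<open>The next direction still sees its original row and column: the negated entries
    there are zero, and every correction has a vanishing factor from \<open>b\<close>.\<close>
  have row: "?b k j = b k j" and col: "?b i k = b i k" and ccol: "?c i k = c i k" for i j
    using k zero by (auto intro!: sum.neutral)
  have "mutate_B (\<lambda>_. 1) k ?b i j =
      (if i \<in> set (ks @ [k]) \<or> j \<in> set (ks @ [k]) then - b i j
       else b i j + (\<Sum>k\<in>set (ks @ [k]). b i k * pos (b k j) + pos (- b i k) * b k j))" for i j
    unfolding mutate_B_def row col using k zero by auto
  moreover have "mutate_C (\<lambda>_. 1) k ?b ?c i j =
      (if j \<in> set (ks @ [k]) then - c i j
       else c i j + (\<Sum>k\<in>set (ks @ [k]). c i k * pos (b k j) + pos (- c i k) * b k j))" for i j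
    unfolding mutate_C_def row ccol using k zero by auto
  moreover have "mutate_G I (\<lambda>_. 1) b0 k ?b ?c ?g i j =
      (if j \<in> set (ks @ [k])
       then - g i j + (\<Sum>a\<in>I. g i a * pos (- b a j) - b0 i a * pos (- c a j)) else g i j)" for i j
  proof -
    \<comment> \<open>\<open>?g\<close> and \<open>g\<close> differ only in columns \<open>a\<close>
      from \<open>ks\<close>, where the weight \<open>pos (- b a k)\<close> is zero.\<close>
    have "(\<Sum>a\<in>I. ?g i a * pos (- b a k) - b0 i a * pos (- c a k)) =
        (\<Sum>a\<in>I. g i a * pos (- b a k) - b0 i a * pos (- c a k))"
      using zero[of _ k] by (intro sum.cong) auto
    then show ?thesis
      unfolding mutate_G_def col ccol using k by auto
  qed
  moreover have "fold (mutate I (\<lambda>_. 1) b0) ks (b, c, g) = (?b, ?c, ?g)"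
    using snoc by simp
  ultimately show ?case
    by (simp add: fun_eq_iff)
qed

lemma composite_mutate_eq:
  assumes "\<forall>l\<in>{1..r k}. \<forall>l'\<in>{1..r k}. b (k, l) (k, l') = 0"
  shows "composite_mutate n r b0 k (b, c, g) =
    (\<lambda>i j. if i \<in> {k} \<times> {1..r k} \<or> j \<in> {k} \<times> {1..r k} then - b i j
       else b i j + (\<Sum>l=1..r k. b i (k, l) * pos (b (k, l) j) + pos (- b i (k, l)) * b (k, l) j),
     \<lambda>i j. if j \<in> {k} \<times> {1..r k} then - c i j
       else c i j + (\<Sum>l=1..r k. c i (k, l) * pos (b (k, l) j) + pos (- c i (k, l)) * b (k, l) j),
     \<lambda>i j. if j \<in> {k} \<times> {1..r k}
       then - g i j + (\<Sum>a\<in>composite_index n r.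
         g i a * pos (- b a j) - composite_matrix b0 i a * pos (- c a j)) else g i j)"
proof -
  define ks where "ks = map (Pair k) [1..<Suc (r k)]"
  have set_ks: "set ks = {k} \<times> {1..r k}"
    by (auto simp: ks_def)
  have "distinct ks"
    by (simp add: ks_def distinct_map inj_on_def)
  moreover have "b x y = 0" if "x \<in> set ks" "y \<in> set ks" for x y
    using that assms unfolding set_ks by auto
  moreover have "sum f ({k} \<times> {1..r k}) = (\<Sum>l=1..r k. f (k, l))" for f :: "nat \<times> nat \<Rightarrow> int"
    by (simp add: sum.cartesian_product[symmetric, where g = "\<lambda>x y. f (x, y)", simplified])
  moreover have "composite_mutate n r b0 k =
      fold (mutate (composite_index n r) (\<lambda>_. 1) (composite_matrix b0)) ks"
    unfolding composite_mutate_def ks_def fold_map by (simp add: comp_def)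
  ultimately show ?thesis
    using fold_mutate_unrelated[of ks b "composite_index n r" "composite_matrix b0" c g]
    by (simp only: set_ks)
qed

section \<open>Block matrices\<close>

text \<open>Inverse to \<open>tilde\<close>: on a matrix of this form, \<open>tilde s\<close>
  returns \<open>a\<close>, which is constant on blocks. Independence of the inner indices thus
  follows once a matrix is known to be a \<open>blowup\<close>.\<close>

definition blowup :: "(nat \<Rightarrow> int) \<Rightarrow> nat mat \<Rightarrow> (nat \<times> nat) mat" where
  "blowup s a \<iota> \<kappa> = a (fst \<iota>) (fst \<kappa>) + s (fst \<kappa>) * delta \<iota> \<kappa>"

text \<open>In a diagonal block, \<open>m\<close> lies in the range of \<open>l\<close>, so the
  signed identity is met exactly once.\<close>

lemma sum_blowup_left:
  assumes "m \<in> {1..r j}"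
  shows "(\<Sum>l=1..r i. blowup s a (i, l) (j, m)) = int (r i) * a i j + s j * delta i j"
proof (cases "i = j")
  case True
  have "(\<Sum>l=1..r i. s j * delta l m) = s j"
    using assms True by (simp add: of_bool_def if_distrib cong: if_cong)
  then show ?thesis
    using True by (simp add: blowup_def sum.distrib)
qed (simp add: blowup_def)

lemma sum_blowup_right:
  assumes "l \<in> {1..r i}"
  shows "(\<Sum>m=1..r j. blowup s a (i, l) (j, m)) = int (r j) * a i j + s j * delta i j"
proof (cases "i = j")
  case True
  have "(\<Sum>m=1..r j. s j * delta l m) = s j"
    using assms True by (simp add: of_bool_def if_distrib cong: if_cong)
  then show ?thesis
    using True by (simp add: blowup_def sum.distrib)
qed (simp add: blowup_def)

text \<open>Integrality is decisive: all entries of a block are \<open>a i j\<close> or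
  \<open>a i j + s j\<close>, two consecutive integers, and zero never lies strictly between
  those.\<close>

lemma blowup_block_sign:
  assumes "s j = 1 \<or> s j = -1"
  shows "(\<forall>l m. blowup s a (i, l) (j, m) \<ge> 0) \<or> (\<forall>l m. blowup s a (i, l) (j, m) \<le> 0)"
  using assms by (cases "a i j \<ge> 0"; cases "a i j = 0"; cases "s j = 1") (auto simp: blowup_def)

text \<open>On values of one sign, the negative part is either zero or the negation, and both are
  additive.\<close>

lemma sum_pos_uminus:
  fixes f :: "'a \<Rightarrow> int"
  assumes "(\<forall>x. f x \<ge> 0) \<or> (\<forall>x. f x \<le> 0)"
  shows "(\<Sum>x\<in>A. pos (- f x)) = pos (- sum f A)"
  using assms
proof
  assume "\<forall>x. f x \<le> 0"
  then have "pos (- f x) = - f x" for x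
    by (intro max_absorb1) simp
  moreover have "sum f A \<le> 0"
    using \<open>\<forall>x. f x \<le> 0\<close> by (simp add: sum_nonpos)
  ultimately show ?thesis
    by (simp add: sum_negf)
qed (simp add: max_def sum_nonneg)

lemma sum_composite_index:
  "sum f (composite_index n r) = (\<Sum>i=1..n. \<Sum>l=1..r i. f (i, l))"
proof -
  have "composite_index n r = Sigma {1..n} (\<lambda>i. {1..r i})"
    by (auto simp: composite_index_def)
  then show ?thesis
    by (simp add: sum.Sigma)
qed

text \<open>For \<open>a\<close> taken from a composite \<open>C\<close>-matrix, the right-hand side
  is the negative part of an entry of the generalized \<open>C\<close>-matrix. In this form
  \<open>C\<close> enters the mutation of \<open>G\<close>.\<close>

lemma sum_pos_blowup_left:
  assumes "s j = 1 \<or> s j = -1" "m \<in> {1..r j}"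
  shows "(\<Sum>l=1..r i. pos (- blowup s a (i, l) (j, m))) = pos (- (int (r i) * a i j + s j * delta i j))"
  unfolding sum_blowup_left[where r = r, OF assms(2), symmetric]
  using blowup_block_sign[of s j, OF assms(1)] by (intro sum_pos_uminus) blast

text \<open>Serves the mutation of \<open>C\<close>, where the summation runs along a row and
  therefore yields the column degree \<open>r j\<close>.\<close>

lemma sum_pos_blowup_right:
  assumes "s j = 1 \<or> s j = -1" "l \<in> {1..r i}"
  shows "(\<Sum>m=1..r j. pos (- blowup s a (i, l) (j, m))) = pos (- (int (r j) * a i j + s j * delta i j))"
  unfolding sum_blowup_right[where r = r, OF assms(2), symmetric]
  using blowup_block_sign[of s j, OF assms(1)] by (intro sum_pos_uminus) blast

section \<open>Generalized mutations as composite mutations\<close>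

text \<open>Invariant of the induction along the tree: the same integer matrices \<open>a\<close>
  and \<open>h\<close> describe both patterns. \<open>C\<close> carries the row degree
  \<open>r i\<close> because it arises by summing a block over its rows, \<open>G\<close> the column
  degree \<open>r j\<close> because it arises by summing over columns.\<close>

fun unfolds ::
  "nat \<Rightarrow> (nat \<Rightarrow> nat) \<Rightarrow> (nat \<Rightarrow> int) \<Rightarrow> nat mat \<Rightarrow> nat mat \<Rightarrow>
    nat mat \<times> nat mat \<times> nat mat \<Rightarrow>
    (nat \<times> nat) mat \<times> (nat \<times> nat) mat \<times> (nat \<times> nat) mat \<Rightarrow> bool" where
  "unfolds n r s a h (B, C, G) (b, c, g) \<longleftrightarrow> (\<forall>i\<in>{1..n}. \<forall>j\<in>{1..n}.
    C i j = int (r i) * a i j + s j * delta i j \<and>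
    G i j = int (r j) * h i j + s j * delta i j \<and>
    (\<forall>l\<in>{1..r i}. \<forall>m\<in>{1..r j}. b (i, l) (j, m) = B i j \<and>
      c (i, l) (j, m) = blowup s a (i, l) (j, m) \<and> g (i, l) (j, m) = blowup s h (i, l) (j, m)))"

text \<open>One generalized mutation is matched with a batch of \<open>r k\<close> composite ones.
  The new \<open>a'\<close> and \<open>h'\<close> are dictated by the composite side; the
  generalized formulas are then checked to agree with them up to the degrees \<open>r i\<close> and
  \<open>r j\<close>.\<close>

lemma unfolds_mutate:
  assumes unf: "unfolds n r s a h (B, C, G) (b, c, g)"
    and k: "k \<in> {1..n}" and diag: "B k k = 0" and sk: "s k = 1 \<or> s k = -1"
    and s': "\<And>i. i \<in> {1..n} \<Longrightarrow> s' i = (if i = k then - s i else s i)"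
    and gen: "agree_on {1..n} (B', C', G') (mutate {1..n} r b0 k (B, C, G))"
    and comp: "agree_on (composite_index n r) (b', c', g') (composite_mutate n r b0 k (b, c, g))"
  shows "\<exists>a h. unfolds n r s' a h (B', C', G') (b', c', g')"
proof -
  have
    C: "\<And>i j. i \<in> {1..n} \<Longrightarrow> j \<in> {1..n} \<Longrightarrow> C i j = int (r i) * a i j + s j * delta i j" and
    G: "\<And>i j. i \<in> {1..n} \<Longrightarrow> j \<in> {1..n} \<Longrightarrow> G i j = int (r j) * h i j + s j * delta i j" and
    b: "\<And>i j l m. i \<in> {1..n} \<Longrightarrow> j \<in> {1..n} \<Longrightarrow> l \<in> {1..r i} \<Longrightarrow> m \<in> {1..r j} \<Longrightarrow>
      b (i, l) (j, m) = B i j" and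
    c: "\<And>i j l m. i \<in> {1..n} \<Longrightarrow> j \<in> {1..n} \<Longrightarrow> l \<in> {1..r i} \<Longrightarrow> m \<in> {1..r j} \<Longrightarrow>
      c (i, l) (j, m) = blowup s a (i, l) (j, m)" and
    g: "\<And>i j l m. i \<in> {1..n} \<Longrightarrow> j \<in> {1..n} \<Longrightarrow> l \<in> {1..r i} \<Longrightarrow> m \<in> {1..r j} \<Longrightarrow>
      g (i, l) (j, m) = blowup s h (i, l) (j, m)"
    using unf by simp_all
  \<comment> \<open>\<open>row i\<close> is the sum of the entries of \<open>c\<close> in row
    \<open>(i, l)\<close> over block column \<open>k\<close>, the same for each \<open>l\<close>.
    Negating that block column flips both \<open>a\<close> and the sign, hence
    \<open>- a i k\<close> in \<open>a'\<close> and \<open>- s k\<close> in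
    \<open>s'\<close>.\<close>
  define row where "row i = int (r k) * a i k + s k * delta i k" for i
  define a' where "a' i j = (if j = k then - a i k
      else a i j + (row i * pos (B k j) + pos (- row i) * B k j))" for i j
  \<comment> \<open>\<open>S i\<close> is the sum in the generalized mutation of \<open>G\<close>
    without its factor \<open>r k\<close>. Each column \<open>(k, m)\<close> gains
    \<open>S i\<close> once, and \<open>r k\<close> reappears as the column degree of
    \<open>G\<close>.\<close>
  define S where "S i = (\<Sum>p=1..n. G i p * pos (- B p k) - b0 i p * pos (- C p k))" for i
  define h' where "h' i j = (if j = k then - h i k + S i else h i j)" for i j

  have zero: "\<forall>l\<in>{1..r k}. \<forall>l'\<in>{1..r k}. b (k, l) (k, l') = 0"
    using b[OF k k] diag by simp
  have comp': "b' x y = (if x \<in> {k} \<times> {1..r k} \<or> y \<in> {k} \<times> {1..r k} then - b x y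
       else b x y + (\<Sum>l=1..r k. b x (k, l) * pos (b (k, l) y) + pos (- b x (k, l)) * b (k, l) y))"
    "c' x y = (if y \<in> {k} \<times> {1..r k} then - c x y
       else c x y + (\<Sum>l=1..r k. c x (k, l) * pos (b (k, l) y) + pos (- c x (k, l)) * b (k, l) y))"
    "g' x y = (if y \<in> {k} \<times> {1..r k}
       then - g x y + (\<Sum>z\<in>composite_index n r.
         g x z * pos (- b z y) - composite_matrix b0 x z * pos (- c z y)) else g x y)"
    if "x \<in> composite_index n r" "y \<in> composite_index n r" for x y
    using comp that unfolding composite_mutate_eq[of r k b, OF zero] agree_on.simps by blast+
  have gen': "B' i j = mutate_B r k B i j" "C' i j = mutate_C r k B C i j"
    "G' i j = mutate_G {1..n} r b0 k B C G i j" if "i \<in> {1..n}" "j \<in> {1..n}" for i j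
    using gen that by auto

  have "C' i j = int (r i) * a' i j + s' j * delta i j" if ij: "i \<in> {1..n}" "j \<in> {1..n}" for i j
  proof (cases "j = k")
    case True
    then show ?thesis
      using ij by (simp add: gen' mutate_C_def a'_def s' C)
  next
    case False
    \<comment> \<open>If \<open>i = k\<close> the degrees coincide, and otherwise the delta term
      vanishes. So the mutation degree \<open>r k\<close> can be traded for the row degree
      \<open>r i\<close>, also inside \<open>pos\<close>, since degrees are nonnegative.\<close>
    have row: "int (r k) * C i k = int (r i) * row i"
      using ij k by (auto simp: C row_def algebra_simps)
    then have "int (r k) * pos (- C i k) = int (r i) * pos (- row i)"
      by (simp add: mult_pos_left)
    then have "int (r k) * (C i k * pos (B k j) + pos (- C i k) * B k j) =
        int (r i) * (row i * pos (B k j) + pos (- row i) * B k j)"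
      using row by (simp only: distrib_left mult.assoc[symmetric])
    then show ?thesis
      using ij False by (simp add: gen' mutate_C_def a'_def s' C[OF ij] algebra_simps)
  qed
  moreover have "G' i j = int (r j) * h' i j + s' j * delta i j"
    if ij: "i \<in> {1..n}" "j \<in> {1..n}" for i j
  proof (cases "j = k")
    case True
    have "G' i k = - G i k + int (r k) * S i"
      by (simp add: gen'(3)[OF ij(1) k] mutate_G_def S_def)
    then show ?thesis
      using ij True by (simp add: G h'_def s' algebra_simps)
  qed (use ij in \<open>simp add: gen' mutate_G_def h'_def s' G\<close>)
  moreover have "b' (i, l) (j, m) = B' i j \<and> c' (i, l) (j, m) = blowup s' a' (i, l) (j, m) \<and>
      g' (i, l) (j, m) = blowup s' h' (i, l) (j, m)"
    if ij: "i \<in> {1..n}" "j \<in> {1..n}" and lm: "l \<in> {1..r i}" "m \<in> {1..r j}" for i j l m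
  proof (intro conjI)
    have idx: "(i, l) \<in> composite_index n r" "(j, m) \<in> composite_index n r"
      using ij lm by (auto simp: composite_index_def)
    \<comment> \<open>All summands coincide, so the batch produces the mutation degree
      \<open>r k\<close>.\<close>
    have "(\<Sum>q=1..r k. b (i, l) (k, q) * pos (b (k, q) (j, m)) + pos (- b (i, l) (k, q)) * b (k, q) (j, m))
        = (\<Sum>q=1..r k. B i k * pos (B k j) + pos (- B i k) * B k j)"
      using ij lm k by (intro sum.cong) (simp_all add: b)
    then show "b' (i, l) (j, m) = B' i j"
      using ij lm by (auto simp: comp'(1)[OF idx] gen' mutate_B_def b)
    show "c' (i, l) (j, m) = blowup s' a' (i, l) (j, m)"
    proof (cases "j = k")
      case True
      then show ?thesis
        unfolding comp'(2)[OF idx] using ij lm by (simp add: c blowup_def a'_def s')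
    next
      case False
      \<comment> \<open>The weights from \<open>b\<close> do not depend on \<open>q\<close>, so
        entries and negative parts are summed separately. The result is free of \<open>l\<close> and
        \<open>m\<close>: the correction is constant on the block and goes into
        \<open>a'\<close>.\<close>
      have "(\<Sum>q=1..r k. c (i, l) (k, q) * pos (b (k, q) (j, m)) + pos (- c (i, l) (k, q)) * b (k, q) (j, m))
          = (\<Sum>q=1..r k. blowup s a (i, l) (k, q) * pos (B k j) + pos (- blowup s a (i, l) (k, q)) * B k j)"
        using ij lm k by (intro sum.cong) (simp_all add: b c)
      also have "\<dots> = row i * pos (B k j) + pos (- row i) * B k j"
        unfolding sum.distrib sum_distrib_right[symmetric] sum_blowup_right[where r = r, OF lm(1)]
          sum_pos_blowup_right[where s = s and r = r, OF sk lm(1)] row_def by (rule refl)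
      finally show ?thesis
        using ij lm False by (simp add: comp'(2)[OF idx] c blowup_def a'_def s')
    qed
    show "g' (i, l) (j, m) = blowup s' h' (i, l) (j, m)"
    proof (cases "j = k")
      case True
      have m: "m \<in> {1..r k}"
        using lm True by simp
      \<comment> \<open>For fixed \<open>p\<close>, \<open>g\<close> is summed along a row and
        \<open>c\<close> along a column, which gives exactly the entries of \<open>G\<close> and
        \<open>C\<close>.\<close>
      have "(\<Sum>q=1..r p. g (i, l) (p, q) * pos (- b (p, q) (k, m))
            - composite_matrix b0 (i, l) (p, q) * pos (- c (p, q) (k, m)))
          = G i p * pos (- B p k) - b0 i p * pos (- C p k)" if p: "p \<in> {1..n}" for p
      proof -
        have "(\<Sum>q=1..r p. g (i, l) (p, q) * pos (- b (p, q) (k, m))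
            - composite_matrix b0 (i, l) (p, q) * pos (- c (p, q) (k, m)))
          = (\<Sum>q=1..r p. blowup s h (i, l) (p, q) * pos (- B p k)
            - b0 i p * pos (- blowup s a (p, q) (k, m)))"
          using ij lm k m p by (intro sum.cong) (simp_all add: b c g composite_matrix_def)
        also have "\<dots> = G i p * pos (- B p k) - b0 i p * pos (- C p k)"
          unfolding sum_subtractf sum_distrib_right[symmetric] sum_distrib_left[symmetric]
            sum_blowup_right[where r = r, OF lm(1)] sum_pos_blowup_left[where s = s and r = r, OF sk m]
            C[OF p k] G[OF ij(1) p] by (rule refl)
        finally show ?thesis .
      qed
      then show ?thesis
        unfolding comp'(3)[OF idx] using ij lm True
        by (simp add: g sum_composite_index S_def blowup_def h'_def s')
    qed (use ij lm in \<open>simp add: comp'(3)[OF idx] g blowup_def h'_def s'\<close>)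
  qed
  ultimately have "unfolds n r s' a' h' (B', C', G') (b', c', g')"
    by simp
  then show ?thesis
    by blast
qed

section \<open>Induction along the tree\<close>

lemma labeled_regular_tree_induct [consumes 3, case_names base step]:
  assumes "labeled_regular_tree n V E lab" "t0 \<in> V" "t \<in> V"
    and base: "P t0"
    and step: "\<And>t t' k. P t \<Longrightarrow> k \<in> {1..n} \<Longrightarrow> k_adjacent E lab k t t' \<Longrightarrow> P t'"
  shows "P t"
proof -
  \<comment> \<open>Connectedness gives a walk from \<open>t0\<close> to \<open>t\<close>. Each edge
    on it has its endpoints in \<open>V\<close>, where the bijection puts its label into
    \<open>{1..n}\<close>.\<close>
  have "(\<lambda>x y. {x, y} \<in> E)\<^sup>*\<^sup>* t0 t"
    using assms by (auto simp: labeled_regular_tree_def tree_graph_def connected_graph_def)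
  then show ?thesis
  proof (induction rule: rtranclp_induct)
    case (step x y)
    have "x \<in> V"
      using assms(1) step(2)
      by (fastforce simp: labeled_regular_tree_def tree_graph_def simple_graph_def doubleton_eq_iff)
    then have "lab {x, y} \<in> {1..n}"
      using assms(1) step(2) by (auto simp: labeled_regular_tree_def dest!: bspec bij_betw_apply)
    then show ?case
      using assms(5) step by (auto simp: k_adjacent_def)
  qed (rule base)
qed

lemma unfolds_pattern:
  assumes "labeled_regular_tree n V E lab" "t0 \<in> V" "t \<in> V"
    and "skew_symmetrizable {1..n} b0"
    and gen: "generalized_pattern n r E lab t0 b0 Bg Cg Gg"
    and comp: "composite_pattern n r E lab t0 b0 Bc Cc Gc"
    and sign: "sign_pattern n E lab t0 \<sigma>"
  shows "\<exists>a h. unfolds n r (\<sigma> t) a h (Bg t, Cg t, Gg t) (Bc t, Cc t, Gc t)"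
proof -
  obtain d where d: "symmetrized_by d {1..n} b0"
    using assms(4) unfolding skew_symmetrizable_def symmetrized_by_def by blast
  \<comment> \<open>Two facts are carried along: the symmetrizer forces \<open>B k k = 0\<close> at
    the next step, and signs \<open>1\<close> or \<open>-1\<close> give each block entries of one
    sign.\<close>
  have "(\<exists>a h. unfolds n r (\<sigma> t) a h (Bg t, Cg t, Gg t) (Bc t, Cc t, Gc t)) \<and>
      symmetrized_by d {1..n} (Bg t) \<and> (\<forall>i\<in>{1..n}. \<sigma> t i = 1 \<or> \<sigma> t i = -1)"
    using assms(1-3)
  proof (induction rule: labeled_regular_tree_induct)
    case base
    \<comment> \<open>All matrices \<open>C\<close> and \<open>G\<close> start as identities and all
      signs as \<open>1\<close>, which leaves zero for \<open>a\<close> and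
      \<open>h\<close>.\<close>
    have "unfolds n r (\<sigma> t0) (\<lambda>_ _. 0) (\<lambda>_ _. 0) (Bg t0, Cg t0, Gg t0) (Bc t0, Cc t0, Gc t0)"
      using gen comp sign
      by (auto simp: generalized_pattern_def composite_pattern_def sign_pattern_def
          composite_index_def composite_matrix_def blowup_def)
    moreover have "symmetrized_by d {1..n} (Bg t0)"
      by (rule symmetrized_by_cong[THEN iffD2, OF _ d])
        (use gen in \<open>simp add: generalized_pattern_def\<close>)
    moreover have "\<forall>i\<in>{1..n}. \<sigma> t0 i = 1 \<or> \<sigma> t0 i = -1"
      using sign by (simp add: sign_pattern_def)
    ultimately show ?case
      by (intro conjI exI)
  next
    case (step t t' k)
    have s': "\<sigma> t' i = (if i = k then - \<sigma> t i else \<sigma> t i)" if "i \<in> {1..n}" for i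
      using sign step that by (simp add: sign_pattern_def)
    have g': "agree_on {1..n} (Bg t', Cg t', Gg t') (mutate {1..n} r b0 k (Bg t, Cg t, Gg t))"
      using gen step by (simp add: generalized_pattern_def)
    have c': "agree_on (composite_index n r) (Bc t', Cc t', Gc t')
        (composite_mutate n r b0 k (Bc t, Cc t, Gc t))"
      using comp step by (simp add: composite_pattern_def)
    obtain a h where "unfolds n r (\<sigma> t) a h (Bg t, Cg t, Gg t) (Bc t, Cc t, Gc t)"
      and sym: "symmetrized_by d {1..n} (Bg t)" and sgn: "\<forall>i\<in>{1..n}. \<sigma> t i = 1 \<or> \<sigma> t i = -1"
      using step.IH by (elim conjE exE)
    then have "\<exists>a h. unfolds n r (\<sigma> t') a h (Bg t', Cg t', Gg t') (Bc t', Cc t', Gc t')"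
      using symmetrized_by_diagonal[OF sym \<open>k \<in> {1..n}\<close>] sgn \<open>k \<in> {1..n}\<close>
      by (intro unfolds_mutate[OF _ _ _ _ s' g' c']) (assumption | blast)+
    moreover have "symmetrized_by d {1..n} (Bg t')"
    proof -
      have "symmetrized_by d {1..n} (mutate_B r k (Bg t))"
        by (rule symmetrized_by_mutate_B[OF sym \<open>k \<in> {1..n}\<close>])
      then show ?thesis
        by (rule symmetrized_by_cong[THEN iffD2, rotated]) (use g' in simp)
    qed
    moreover have "\<forall>i\<in>{1..n}. \<sigma> t' i = 1 \<or> \<sigma> t' i = -1"
      using sgn s' by force
    ultimately show ?case
      by (intro conjI)
  qed
  then show ?thesis ..
qed

theorem proposition6p2:
  fixes n :: nat and r :: "nat \<Rightarrow> nat"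
    and V :: "'v set" and E :: "'v set set" and lab :: "'v set \<Rightarrow> nat" and t0 :: 'v
    and b0 :: "nat mat"
    and Bg Cg Gg :: "'v \<Rightarrow> nat mat"
    and Bc Cc Gc :: "'v \<Rightarrow> (nat \<times> nat) mat"
    and \<sigma> :: "'v \<Rightarrow> nat \<Rightarrow> int"
  assumes "n \<ge> 1"
    and "\<forall>i\<in>{1..n}. r i \<ge> 1"
    and "labeled_regular_tree n V E lab"
    and "t0 \<in> V"
    and "skew_symmetrizable {1..n} b0"
    and "generalized_pattern n r E lab t0 b0 Bg Cg Gg"
    and "composite_pattern n r E lab t0 b0 Bc Cc Gc"
    and "sign_pattern n E lab t0 \<sigma>"
  shows "\<forall>i\<in>{1..n}. \<forall>j\<in>{1..n}. \<forall>t\<in>V.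
      \<forall>l0\<in>{1..r i}. \<forall>m0\<in>{1..r j}. \<forall>l1\<in>{1..r i}. \<forall>m1\<in>{1..r j}.
        Cg t i j = (\<Sum>l=1..r i. Cc t (i, l) (j, m0)) \<and>
        rat_of_int (Cg t i j) =
          rat_of_nat (r i) / rat_of_nat (r j) * rat_of_int (\<Sum>m=1..r j. Cc t (i, l0) (j, m)) \<and>
        Cg t i j = int (r i) * tilde (\<sigma> t) (Cc t) (i, l1) (j, m1) + \<sigma> t j * delta i j \<and>
        Gg t i j = (\<Sum>m=1..r j. Gc t (i, l0) (j, m)) \<and>
        rat_of_int (Gg t i j) =
          rat_of_nat (r j) / rat_of_nat (r i) * rat_of_int (\<Sum>l=1..r i. Gc t (i, l) (j, m0)) \<and>
        Gg t i j = int (r j) * tilde (\<sigma> t) (Gc t) (i, l1) (j, m1) + \<sigma> t j * delta i j"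
proof (intro ballI)
  fix i j t l0 m0 l1 m1
  assume ij: "i \<in> {1..n}" "j \<in> {1..n}" and t: "t \<in> V"
    and l0: "l0 \<in> {1..r i}" and m0: "m0 \<in> {1..r j}"
    and l1: "l1 \<in> {1..r i}" and m1: "m1 \<in> {1..r j}"
  obtain a h where "unfolds n r (\<sigma> t) a h (Bg t, Cg t, Gg t) (Bc t, Cc t, Gc t)"
    using unfolds_pattern[OF assms(3,4) t assms(5-8)] by blast
  then have
    C: "Cg t i j = int (r i) * a i j + \<sigma> t j * delta i j" and
    G: "Gg t i j = int (r j) * h i j + \<sigma> t j * delta i j" and
    c: "\<And>l m. l \<in> {1..r i} \<Longrightarrow> m \<in> {1..r j} \<Longrightarrow> Cc t (i, l) (j, m) = blowup (\<sigma> t) a (i, l) (j, m)" and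
    g: "\<And>l m. l \<in> {1..r i} \<Longrightarrow> m \<in> {1..r j} \<Longrightarrow> Gc t (i, l) (j, m) = blowup (\<sigma> t) h (i, l) (j, m)"
    using ij by simp_all
  have sums: "(\<Sum>l=1..r i. Cc t (i, l) (j, m0)) = int (r i) * a i j + \<sigma> t j * delta i j"
    "(\<Sum>m=1..r j. Cc t (i, l0) (j, m)) = int (r j) * a i j + \<sigma> t j * delta i j"
    "(\<Sum>l=1..r i. Gc t (i, l) (j, m0)) = int (r i) * h i j + \<sigma> t j * delta i j"
    "(\<Sum>m=1..r j. Gc t (i, l0) (j, m)) = int (r j) * h i j + \<sigma> t j * delta i j"
    using sum_blowup_left[where r = r, OF m0] sum_blowup_right[where r = r, OF l0] l0 m0 c g by simp_all
  \<comment> \<open>The values do not mention \<open>l1\<close> and \<open>m1\<close>: independence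
    of the inner indices is proved here.\<close>
  have tilde: "tilde (\<sigma> t) (Cc t) (i, l1) (j, m1) = a i j" "tilde (\<sigma> t) (Gc t) (i, l1) (j, m1) = h i j"
    using l1 m1 by (simp_all add: tilde_def c g blowup_def)
  \<comment> \<open>If \<open>i = j\<close> the ratio is one; otherwise the delta term vanishes and
    \<open>q\<close> cancels. The degrees \<open>p\<close>, \<open>q\<close> are \<open>r i\<close>,
    \<open>r j\<close> for \<open>C\<close> and swapped for \<open>G\<close>.\<close>
  have scale: "rat_of_int (int p * x + y * delta i j) =
      rat_of_nat p / rat_of_nat q * rat_of_int (int q * x + y * delta i j)"
    if "q > 0" "i = j \<Longrightarrow> p = q" for p q x y
    using that by (cases "i = j") simp_all
  have "r i > 0" "r j > 0"
    using l0 m0 by auto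
  then show "Cg t i j = (\<Sum>l=1..r i. Cc t (i, l) (j, m0)) \<and>
        rat_of_int (Cg t i j) =
          rat_of_nat (r i) / rat_of_nat (r j) * rat_of_int (\<Sum>m=1..r j. Cc t (i, l0) (j, m)) \<and>
        Cg t i j = int (r i) * tilde (\<sigma> t) (Cc t) (i, l1) (j, m1) + \<sigma> t j * delta i j \<and>
        Gg t i j = (\<Sum>m=1..r j. Gc t (i, l0) (j, m)) \<and>
        rat_of_int (Gg t i j) =
          rat_of_nat (r j) / rat_of_nat (r i) * rat_of_int (\<Sum>l=1..r i. Gc t (i, l) (j, m0)) \<and>
        Gg t i j = int (r j) * tilde (\<sigma> t) (Gc t) (i, l1) (j, m1) + \<sigma> t j * delta i j"
    unfolding sums tilde C G by (intro conjI refl scale) simp_all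
qed

end
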